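(* Let $\mathcal G$ be an $\mathrm{MD}_{n-2}(n)$-algebra with $n\ge6$, $\dim\mathcal G^1=2$ and $\mathcal G^1$ contained in the centre of $\mathcal G$. (a) If $n=6$, then $\mathcal G$ is isomorphic to the Lie algebra with basis $\{x_1,\dots,x_6\}$ whose only nonzero brackets (up to antisymmetry) are $[x_1,x_3]=x_5$, $[x_1,x_4]=-x_6$, $[x_2,x_3]=-x_6$, $[x_2,x_4]=-x_5$. (b) If $n=10$, then $\mathcal G$ is isomorphic to one of the following Lie algebras on a basis $\{x_1,\dots,x_{10}\}$ (only nonzero brackets listed, up to antisymmetry): $\mathcal G_{10,1}(\mu,\lambda)$ with $\mu\in\mathbb R$, $0<|\lambda|\le1$: $[x_1,x_3]=x_9$, $[x_1,x_4]=-x_{10}$, $[x_2,x_3]=-x_{10}$, $[x_2,x_4]=-x_9$, $[x_5,x_7]=\lambda x_9$, $[x_5,x_8]=\mu x_9-x_{10}$, $[x_6,x_7]=\mu x_9-x_{10}$, $[x_6,x_8]=-\lambda x_9$; $\mathcal G_{10,2}(\lambda)$ with $\lambda\neq0$: $[x_1,x_7]=\lambda x_9$, $[x_1,x_8]=-x_{10}$, $[x_2,x_7]=-x_{10}$, $[x_2,x_8]=-\lambda x_9$, $[x_3,x_5]=\lambda x_9$, $[x_3,x_6]=-x_{10}$, $[x_3,x_8]=x_9$, $[x_4,x_5]=-x_{10}$, $[x_4,x_6]=-\lambda x_9$, $[x_4,x_7]=x_9$.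
   Context: $\mathcal G^1=[\mathcal G,\mathcal G]$. An $\mathrm{MD}_k(n)$-algebra is an $n$-dimensional real solvable Lie algebra all of whose non-trivial coadjoint orbits (for its connected simply connected Lie group; $\dim\Omega_F=\operatorname{rank}(F([x_i,x_j]))$ for a basis $\{x_i\}$, non-trivial iff $F|_{\mathcal G^1}\ne0$) have dimension $k$. *)

theory Defs
  imports "HOL-Analysis.Analysis"
begin

text \<open>A real Lie algebra structure on a finite-dimensional real vector space 'a
  (an n-dimensional space is modelled by a euclidean_space type with DIM('a) = n).\<close>

definition lie_algebra :: "('a::euclidean_space \<Rightarrow> 'a \<Rightarrow> 'a) \<Rightarrow> bool" where
  "lie_algebra br \<longleftrightarrow> bilinear br \<and> (\<forall>x. br x x = 0) \<and>
     (\<forall>x y z. br x (br y z) + br y (br z x) + br z (br x y) = 0)"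

fun derived_series :: "('a::euclidean_space \<Rightarrow> 'a \<Rightarrow> 'a) \<Rightarrow> nat \<Rightarrow> 'a set" where
  "derived_series br 0 = UNIV"
| "derived_series br (Suc k) =
     span {br x y | x y. x \<in> derived_series br k \<and> y \<in> derived_series br k}"

definition derived :: "('a::euclidean_space \<Rightarrow> 'a \<Rightarrow> 'a) \<Rightarrow> 'a set" where
  "derived br = span {br x y | x y. True}"

definition solvable_lie :: "('a::euclidean_space \<Rightarrow> 'a \<Rightarrow> 'a) \<Rightarrow> bool" where
  "solvable_lie br \<longleftrightarrow> (\<exists>k. derived_series br k = {0})"

definition centre :: "('a::euclidean_space \<Rightarrow> 'a \<Rightarrow> 'a) \<Rightarrow> 'a set" where
  "centre br = {z. \<forall>x. br z x = 0}"

text \<open>Dimension of the coadjoint orbit of F: the rank of the matrix (F([x_i,x_j]))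
  for the basis {x_i} = Basis, i.e. the dimension of the span of its rows; the row
  of x is encoded as the vector sum_j F([x,x_j]) x_j.\<close>
definition orbit_dim :: "('a::euclidean_space \<Rightarrow> 'a \<Rightarrow> 'a) \<Rightarrow> ('a \<Rightarrow> real) \<Rightarrow> nat" where
  "orbit_dim br F = dim (span ((\<lambda>x. \<Sum>b\<in>Basis. F (br x b) *\<^sub>R b) ` Basis))"

text \<open>MD_k(n)-algebra, n = DIM('a): solvable real Lie algebra all of whose non-trivial
  coadjoint orbits (F restricted to G^1 nonzero) have dimension k.\<close>
definition MD_algebra :: "nat \<Rightarrow> ('a::euclidean_space \<Rightarrow> 'a \<Rightarrow> 'a) \<Rightarrow> bool" where
  "MD_algebra k br \<longleftrightarrow> lie_algebra br \<and> solvable_lie br \<and>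
     (\<forall>F. linear F \<and> (\<exists>u\<in>derived br. F u \<noteq> 0) \<longrightarrow> orbit_dim br F = k)"

text \<open>Structure constants: a table t i j (meaningful for i < j) gives the coefficient
  vector of [x_i, x_j]; extended by antisymmetry.\<close>
definition ev :: "nat \<Rightarrow> nat \<Rightarrow> real" where
  "ev k m = (if m = k then 1 else 0)"

definition antisym_ext :: "(nat \<Rightarrow> nat \<Rightarrow> nat \<Rightarrow> real) \<Rightarrow> nat \<Rightarrow> nat \<Rightarrow> nat \<Rightarrow> real" where
  "antisym_ext t i j k = (if i < j then t i j k else if j < i then - t j i k else 0)"

definition iso_to :: "('a::euclidean_space \<Rightarrow> 'a \<Rightarrow> 'a) \<Rightarrow> nat \<Rightarrow> (nat \<Rightarrow> nat \<Rightarrow> nat \<Rightarrow> real) \<Rightarrow> bool" where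
  "iso_to br n c \<longleftrightarrow> (\<exists>x :: nat \<Rightarrow> 'a.
      inj_on x {1..n} \<and> independent (x ` {1..n}) \<and> span (x ` {1..n}) = UNIV \<and>
      (\<forall>i\<in>{1..n}. \<forall>j\<in>{1..n}. br (x i) (x j) = (\<Sum>k=1..n. antisym_ext c i j k *\<^sub>R x k)))"

definition g6 :: "nat \<Rightarrow> nat \<Rightarrow> nat \<Rightarrow> real" where
  "g6 i j k = (if (i,j) = (1,3) then ev 5 k
        else if (i,j) = (1,4) then - ev 6 k
        else if (i,j) = (2,3) then - ev 6 k
        else if (i,j) = (2,4) then - ev 5 k
        else 0)"

definition g10_1 :: "real \<Rightarrow> real \<Rightarrow> nat \<Rightarrow> nat \<Rightarrow> nat \<Rightarrow> real" where
  "g10_1 m l i j k = (if (i,j) = (1,3) then ev 9 k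
        else if (i,j) = (1,4) then - ev 10 k
        else if (i,j) = (2,3) then - ev 10 k
        else if (i,j) = (2,4) then - ev 9 k
        else if (i,j) = (5,7) then l * ev 9 k
        else if (i,j) = (5,8) then m * ev 9 k - ev 10 k
        else if (i,j) = (6,7) then m * ev 9 k - ev 10 k
        else if (i,j) = (6,8) then - (l * ev 9 k)
        else 0)"

definition g10_2 :: "real \<Rightarrow> nat \<Rightarrow> nat \<Rightarrow> nat \<Rightarrow> real" where
  "g10_2 l i j k = (if (i,j) = (1,7) then l * ev 9 k
        else if (i,j) = (1,8) then - ev 10 k
        else if (i,j) = (2,7) then - ev 10 k
        else if (i,j) = (2,8) then - (l * ev 9 k)
        else if (i,j) = (3,5) then l * ev 9 k
        else if (i,j) = (3,6) then - ev 10 k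
        else if (i,j) = (3,8) then ev 9 k
        else if (i,j) = (4,5) then - ev 10 k
        else if (i,j) = (4,6) then - (l * ev 9 k)
        else if (i,j) = (4,7) then ev 9 k
        else 0)"

end

theory Submission
  imports Defs "HOL-Computational_Algebra.Fundamental_Theorem_Algebra"
begin

text \<open>On a complement \<open>W\<close> of the derived algebra the bracket is a pair of alternating forms
  \<open>a\<close> and \<open>a (T _) _\<close>; the orbit condition says that every nontrivial combination of them is
  nondegenerate, i.e. \<open>a\<close> is symplectic and the \<open>a\<close>-selfadjoint operator \<open>T\<close> has no real
  eigenvalue. Changing the basis of the derived algebra replaces \<open>T\<close> by \<open>(T - u) / v\<close>, so one may
  assume that \<open>Q = T\<^sup>2 + 1\<close> has a kernel vector \<open>x\<close>. Cyclic subspaces of \<open>T\<close> are isotropic, hence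
  the forms on the sum of two of them are determined by the pairing of one generator with the
  orbit of the other, and this pairing can be prescribed. In dimension 10, either \<open>x\<close> pairs
  nontrivially with \<open>ker Q\<close>, and \<open>W\<close> splits orthogonally; or \<open>x = Q z\<close>, and \<open>z\<close> generates a
  four-dimensional cyclic subspace on which \<open>Q\<^sup>2 = 0\<close>.\<close>

section \<open>Polynomials in a linear operator\<close>

definition poly_op :: "('a::real_vector \<Rightarrow> 'a) \<Rightarrow> real poly \<Rightarrow> 'a \<Rightarrow> 'a" where
  "poly_op T p = fold_coeffs (\<lambda>c f x. c *\<^sub>R x + T (f x)) p (\<lambda>x. 0)"

lemma poly_op_0 [simp]: "poly_op T 0 x = 0"
  by (simp add: poly_op_def)

lemma poly_op_pCons:
  assumes "linear T"
  shows "poly_op T (pCons c p) x = c *\<^sub>R x + T (poly_op T p x)"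
proof (cases "p = 0 \<and> c = 0")
  case True
  then show ?thesis using assms by (simp add: linear_0)
next
  case False
  then show ?thesis by (auto simp: poly_op_def fold_coeffs_pCons_coeff_not_0_eq fold_coeffs_pCons_not_0_0_eq)
qed

lemma poly_op_add:
  assumes "linear T"
  shows "poly_op T (p + q) x = poly_op T p x + poly_op T q x"
  by (induct p q rule: poly_induct2)
    (simp_all add: poly_op_pCons assms linear_add[OF assms] algebra_simps)

lemma poly_op_smult:
  assumes "linear T"
  shows "poly_op T (smult c p) x = c *\<^sub>R poly_op T p x"
  by (induct p) (simp_all add: poly_op_pCons assms linear_scale[OF assms] algebra_simps)

lemma poly_op_mult:
  assumes "linear T"
  shows "poly_op T (p * q) x = poly_op T p (poly_op T q x)"
  by (induct p) (simp_all add: poly_op_pCons poly_op_add poly_op_smult assms)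

lemma poly_op_monom:
  assumes "linear T"
  shows "poly_op T (monom c n) x = c *\<^sub>R (T ^^ n) x"
proof (induct n)
  case 0
  then show ?case by (simp add: monom_0 poly_op_pCons assms linear_0[OF assms])
next
  case (Suc n)
  then show ?case by (simp add: monom_Suc poly_op_pCons assms linear_scale[OF assms])
qed

lemma poly_op_sum:
  assumes "linear T"
  shows "poly_op T (\<Sum>i\<in>I. f i) x = (\<Sum>i\<in>I. poly_op T (f i) x)"
  by (induct I rule: infinite_finite_induct) (simp_all add: poly_op_add assms)

lemma poly_op_mem:
  assumes "linear T" "subspace W" "\<And>x. x \<in> W \<Longrightarrow> T x \<in> W" "x \<in> W"
  shows "poly_op T p x \<in> W"
  by (induct p) (simp_all add: assms poly_op_pCons subspace_0 subspace_add subspace_scale)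

text \<open>The \<open>DIM('a) + 1\<close> iterates of \<open>x\<close> cannot be independent, and a
  linear relation among them is a polynomial. Since \<open>dependent\<close> speaks of sets, a
  repetition among the iterates is a case of its own, with the binomial as witness.\<close>

lemma poly_op_annihilates:
  fixes x :: "'a::euclidean_space"
  assumes "linear T"
  shows "\<exists>p. p \<noteq> 0 \<and> poly_op T p x = 0"
proof (cases "inj_on (\<lambda>i. (T ^^ i) x) {..DIM('a)}")
  case False
  then obtain i j where ij: "i \<noteq> j" "(T ^^ i) x = (T ^^ j) x" unfolding inj_on_def by blast
  have "poly_op T (monom 1 i + monom (-1) j) x = 0"
    using ij by (simp add: poly_op_add poly_op_monom assms)
  moreover have "monom 1 i + monom (-1) j \<noteq> (0::real poly)"
  proof
    assume "monom 1 i + monom (-1) j = (0::real poly)"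
    then have "coeff (monom 1 i + monom (-1) j) i = (0::real)" by simp
    with ij show False by simp
  qed
  ultimately show ?thesis by blast
next
  case inj: True
  let ?f = "\<lambda>i. (T ^^ i) x"
  have "card (?f ` {..DIM('a)}) > DIM('a)"
    using inj by (simp add: card_image)
  then have "dependent (?f ` {..DIM('a)})"
    using independent_card_le by (metis leD)
  then obtain u where u: "\<exists>v\<in>?f ` {..DIM('a)}. u v \<noteq> 0" "(\<Sum>v\<in>?f ` {..DIM('a)}. u v *\<^sub>R v) = 0"
    by (auto simp: real_vector.dependent_finite)
  define p where "p = (\<Sum>i\<le>DIM('a). monom (u (?f i)) i)"
  have "coeff p i = u (?f i)" if "i \<le> DIM('a)" for i
    unfolding p_def using that by (simp add: coeff_sum if_distrib sum.delta cong: if_cong)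
  with u(1) have "p \<noteq> 0" by fastforce
  moreover have "poly_op T p x = (\<Sum>i\<le>DIM('a). u (?f i) *\<^sub>R ?f i)"
    by (simp add: p_def poly_op_sum poly_op_monom assms)
  then have "poly_op T p x = 0"
    using u(2) by (simp add: sum.reindex[OF inj])
  ultimately show ?thesis by blast
qed

section \<open>Real factors of polynomials and invariant planes\<close>

lemma poly_op_zero: "linear T \<Longrightarrow> poly_op T p 0 = 0"
  by (induct p) (simp_all add: poly_op_pCons linear_0)

text \<open>Evaluation at a complex number becomes an instance of \<open>poly_op\<close>, so its
  rules for sums and products carry over.\<close>

lemma poly_op_complex_eq: "poly_op ((*) c) p 1 = poly (map_poly complex_of_real p) c"
  by (induct p) (simp_all add: poly_op_pCons linear_times map_poly_pCons scaleR_conv_of_real)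

text \<open>A complex root \<open>c\<close> exists. If it is not real, divide by its real minimal
  polynomial: the remainder has degree below 2, real coefficients and the root \<open>c\<close>, so
  it vanishes.\<close>

lemma real_poly_linear_or_quadratic_factor:
  fixes p :: "real poly"
  assumes "degree p > 0"
  shows "(\<exists>r. [:-r, 1:] dvd p) \<or> (\<exists>u v. v > 0 \<and> [:u\<^sup>2 + v\<^sup>2, -2 * u, 1:] dvd p)"
proof -
  have "\<not> constant (poly (map_poly complex_of_real p))"
    using assms by (simp add: constant_degree degree_map_poly)
  then obtain c where c: "poly (map_poly complex_of_real p) c = 0"
    using fundamental_theorem_of_algebra by blast
  show ?thesis
  proof (cases "Im c = 0")
    case True
    then have "c = of_real (Re c)" by (simp add: complex_eq_iff)
    moreover have "poly (map_poly complex_of_real p) (of_real t) = of_real (poly p t)" for t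
      by (induct p) (simp_all add: map_poly_pCons)
    ultimately have "poly p (Re c) = 0" using c by (metis of_real_eq_0_iff)
    then show ?thesis by (auto simp: poly_eq_0_iff_dvd)
  next
    case False
    \<comment> \<open>This is the product of X - c and X - cnj c.\<close>
    define q where "q = [:(Re c)\<^sup>2 + (Im c)\<^sup>2, -2 * Re c, 1:]"
    define r where "r = p mod q"
    have "q \<noteq> 0" "degree q = 2" by (simp_all add: q_def)
    then have dr: "r = 0 \<or> degree r < 2" unfolding r_def by (metis degree_mod_less)
    obtain r0 r1 where r: "r = [:r0, r1:]"
    proof -
      have "r = [:coeff r 0, coeff r 1:]"
        using dr by (intro poly_eqI) (auto simp: coeff_pCons coeff_eq_0 split: nat.splits)
      then show ?thesis using that by blast
    qed
    have pq: "p = q * (p div q) + r" by (simp add: r_def)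
    have "poly (map_poly complex_of_real q) c = 0"
      by (simp add: q_def map_poly_pCons complex_eq_iff power2_eq_square algebra_simps)
    then have "poly_op ((*) c) q 1 = 0" by (simp add: poly_op_complex_eq)
    then have "poly_op ((*) c) ((p div q) * q + r) 1 = poly_op ((*) c) r 1"
      by (simp only: poly_op_add poly_op_mult linear_times poly_op_zero) simp
    then have "poly (map_poly complex_of_real r) c = 0"
      using c pq by (simp add: poly_op_complex_eq mult.commute)
    then have "Im c * r1 = 0" "r0 + Re c * r1 = 0" by (auto simp: r map_poly_pCons complex_eq_iff)
    then have "r = 0" using False by (simp add: r)
    then have "q dvd p" by (simp add: r_def dvd_eq_mod_eq_0)
    \<comment> \<open>The root may lie in the lower half plane; the absolute value makes
      \<open>v\<close> positive and leaves the square unchanged.\<close>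
    then have "[:(Re c)\<^sup>2 + \<bar>Im c\<bar>\<^sup>2, -2 * Re c, 1:] dvd p" by (simp add: q_def)
    with False show ?thesis by (metis zero_less_abs_iff)
  qed
qed

text \<open>Take an annihilating polynomial \<open>p\<close> of \<open>x0\<close> of least degree
  and write it as \<open>f * q\<close> with \<open>f\<close> linear or quadratic. By minimality
  \<open>poly_op T q x0\<close> is nonzero, and \<open>f\<close> kills it. A linear \<open>f\<close>
  would make it an eigenvector, so \<open>f\<close> is quadratic.\<close>

lemma invariant_plane_exists:
  fixes T :: "'a::euclidean_space \<Rightarrow> 'a"
  assumes T: "linear T" and W: "subspace W" and inv: "\<And>x. x \<in> W \<Longrightarrow> T x \<in> W"
    and no_eig: "\<And>x r. x \<in> W \<Longrightarrow> T x = r *\<^sub>R x \<Longrightarrow> x = 0"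
    and "x0 \<in> W" "x0 \<noteq> 0"
  shows "\<exists>u v x. v > 0 \<and> x \<in> W \<and> x \<noteq> 0 \<and> T (T x) = (2 * u) *\<^sub>R T x - (u\<^sup>2 + v\<^sup>2) *\<^sub>R x"
proof -
  let ?P = "\<lambda>p. p \<noteq> 0 \<and> poly_op T p x0 = 0"
  obtain p where p: "?P p" and least: "\<And>q. ?P q \<Longrightarrow> degree p \<le> degree q"
    using ex_has_least_nat[of ?P _ degree] poly_op_annihilates[OF T, of x0] by metis
  have "degree p > 0"
  proof (rule ccontr)
    assume "\<not> degree p > 0"
    then obtain c where "p = [:c:]" using degree_0_id by (metis bot_nat_0.not_eq_extremum)
    with p assms(6) show False by (simp add: poly_op_pCons T linear_0[OF T])
  qed
  have nz: "poly_op T q x0 \<noteq> 0 \<and> poly_op T f (poly_op T q x0) = 0 \<and> poly_op T q x0 \<in> W"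
    if "p = f * q" "degree f > 0" for f q
  proof -
    have "q \<noteq> 0" "f \<noteq> 0" using p that by auto
    then have "degree q < degree p" using that by (simp add: degree_mult_eq)
    then have "poly_op T q x0 \<noteq> 0" using least[of q] \<open>q \<noteq> 0\<close> by auto
    then show ?thesis
      using p that poly_op_mult[OF T, of f q x0] poly_op_mem[OF T W inv \<open>x0 \<in> W\<close>] by simp
  qed
  from real_poly_linear_or_quadratic_factor[OF \<open>degree p > 0\<close>] show ?thesis
  proof (elim disjE exE conjE)
    fix r assume "[:-r, 1:] dvd p"
    then obtain q where "p = [:-r, 1:] * q" by (elim dvdE)
    from nz[OF this] no_eig[of "poly_op T q x0" r] show ?thesis
      by (simp add: poly_op_pCons T linear_0[OF T])
  next
    fix u v :: real assume "v > 0" and "[:u\<^sup>2 + v\<^sup>2, -2 * u, 1:] dvd p"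
    then obtain q where "p = [:u\<^sup>2 + v\<^sup>2, -2 * u, 1:] * q" by (elim dvdE)
    from nz[OF this] have y: "poly_op T q x0 \<noteq> 0" "poly_op T q x0 \<in> W"
      and "(u\<^sup>2 + v\<^sup>2) *\<^sub>R poly_op T q x0 + T (- ((2 * u) *\<^sub>R poly_op T q x0) + T (poly_op T q x0)) = 0"
      by (simp_all add: poly_op_pCons T linear_0[OF T])
    then have "T (T (poly_op T q x0)) = (2 * u) *\<^sub>R T (poly_op T q x0) - (u\<^sup>2 + v\<^sup>2) *\<^sub>R poly_op T q x0"
      by (simp add: linear_add[OF T] linear_diff[OF T] linear_neg[OF T] linear_scale[OF T] algebra_simps add_eq_0_iff)
    with y \<open>v > 0\<close> show ?thesis by blast
  qed
qed

section \<open>Rank and representation of functionals\<close>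

text \<open>A nonzero kernel vector extends to a basis of \<open>W\<close>, whose other members
  already span the image, which is then too small.\<close>

lemma kernel_trivial_if_dim_image_ge:
  fixes f :: "'a::euclidean_space \<Rightarrow> 'b::euclidean_space"
  assumes f: "linear f" and W: "subspace W" and dim: "dim W \<le> dim (f ` W)"
    and x: "x \<in> W" "f x = 0"
  shows "x = 0"
proof (rule ccontr)
  assume "x \<noteq> 0"
  then obtain B where B: "{x} \<subseteq> B" "B \<subseteq> W" "independent B" "W \<subseteq> span B"
    using maximal_independent_subset_extend[of "{x}" W] x by auto
  have fin: "finite B" using B(3) by (rule independent_imp_finite)
  have "f ` W \<subseteq> span (f ` B)" using B(4) linear_span_image[OF f, of B] by auto
  also have "f ` B \<subseteq> insert 0 (f ` (B - {x}))" using x by auto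
  then have "span (f ` B) \<subseteq> span (f ` (B - {x}))" by (metis span_mono span_insert_0)
  finally have "dim (f ` W) \<le> card (f ` (B - {x}))" using fin by (intro dim_le_card) auto
  also have "\<dots> \<le> card (B - {x})" using fin by (intro card_image_le) auto
  also have "\<dots> < card B" using fin B(1) by (intro psubset_card_mono) auto
  also have "card B = dim W" using basis_card_eq_dim[OF B(2,4,3)] .
  finally show False using dim by simp
qed

text \<open>The map sending a vector to its pairings with a basis of \<open>W\<close> is injective
  by nondegeneracy, hence onto by dimension.\<close>

lemma represent_functional:
  fixes a :: "'a::euclidean_space \<Rightarrow> 'a \<Rightarrow> real"
  assumes a: "bilinear a" and W: "subspace W"
    and nondeg: "\<And>x. x \<in> W \<Longrightarrow> (\<And>y. y \<in> W \<Longrightarrow> a x y = 0) \<Longrightarrow> x = 0"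
    and f: "linear f"
  shows "\<exists>t\<in>W. \<forall>y\<in>W. a t y = f y"
proof -
  obtain B where B: "B \<subseteq> W" "independent B" "W \<subseteq> span B" "card B = dim W"
    using basis_exists by blast
  have fin: "finite B" using B(2) by (rule independent_imp_finite)
  have la: "linear (a x)" "linear (\<lambda>x. a x y)" for x y using a by (auto simp: bilinear_def)
  \<comment> \<open>Storing the pairings as coefficients on \<open>B\<close> itself makes \<Phi> map
    \<open>W\<close> into \<open>W\<close>, so that injectivity yields surjectivity.\<close>
  define \<Phi> where "\<Phi> x = (\<Sum>b\<in>B. a x b *\<^sub>R b)" for x
  have lin: "linear \<Phi>"
    unfolding \<Phi>_def by (intro linear_compose_sum ballI linearI)
      (simp_all add: bilinear_ladd[OF a] bilinear_lmul[OF a] algebra_simps)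
  have coeffs: "g = h" if "(\<Sum>b\<in>B. g b *\<^sub>R b) = (\<Sum>b\<in>B. h b *\<^sub>R b)" "\<And>b. b \<notin> B \<Longrightarrow> g b = h b" for g h
  proof
    fix b
    have "(\<Sum>b\<in>B. (g b - h b) *\<^sub>R b) = 0" using that by (simp add: scaleR_diff_left sum_subtractf)
    then show "g b = h b" using that(2) independentD[OF B(2) fin subset_refl, of "\<lambda>b. g b - h b" b] by fastforce
  qed
  have eqW: "a t y = f y" if "\<And>b. b \<in> B \<Longrightarrow> a t b = f b" "y \<in> W" "linear f" for t y f
    using linear_eq_on_span[OF la(1) that(3), of B t] that B(3) by auto
  have "inj_on \<Phi> W"
  proof (rule inj_onI)
    fix x y assume xy: "x \<in> W" "y \<in> W" "\<Phi> x = \<Phi> y"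
    then have "\<Phi> (x - y) = 0" by (simp add: linear_diff[OF lin])
    then have "a (x - y) b = 0" if "b \<in> B" for b
      using independentD[OF B(2) fin subset_refl] that by (auto simp: \<Phi>_def)
    then have "a (x - y) z = 0" if "z \<in> W" for z
      using eqW[of "x - y" "\<lambda>_. 0" z] that by (simp add: linear_zero)
    then have "x - y = 0" using xy W by (intro nondeg) (auto simp: subspace_diff)
    then show "x = y" by simp
  qed
  then have "dim (\<Phi> ` W) = dim W"
    using W by (intro dim_image_eq lin) (simp add: span_eq_iff[THEN iffD2])
  moreover have "\<Phi> ` W \<subseteq> W" unfolding \<Phi>_def using B(1) W by (auto intro!: subspace_sum subspace_scale)
  ultimately have surj: "\<Phi> ` W = W"
    using subspace_dim_equal[of "\<Phi> ` W" W] linear_subspace_image[OF lin W] W by simp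
  have "(\<Sum>b\<in>B. f b *\<^sub>R b) \<in> W" using B(1) W by (auto intro!: subspace_sum subspace_scale)
  then obtain t where t: "t \<in> W" "\<Phi> t = (\<Sum>b\<in>B. f b *\<^sub>R b)" using surj by (metis imageE)
  have "(\<lambda>b. if b \<in> B then a t b else 0) = (\<lambda>b. if b \<in> B then f b else 0)"
    using t(2) by (intro coeffs) (simp_all add: \<Phi>_def)
  then have "a t b = f b" if "b \<in> B" for b using that by (meson)
  then show ?thesis using eqW[of t f] f t(1) by blast
qed

section \<open>Pencils of alternating forms\<close>

text \<open>For nonzero \<open>v\<close> this affine change moves the eigenvalues u + iv and u - iv
  to i and -i.\<close>

definition rescaled :: "('a::real_vector \<Rightarrow> 'a) \<Rightarrow> real \<Rightarrow> real \<Rightarrow> 'a \<Rightarrow> 'a" where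
  "rescaled T u v x = (1 / v) *\<^sub>R (T x - u *\<^sub>R x)"

text \<open>\<open>a\<close> and \<open>T\<close> live on the whole type and only the conditions
  tied to the subspace refer to \<open>W\<close>; the same \<open>a\<close> and \<open>T\<close>
  thus serve again on an invariant orthogonal summand.\<close>

locale skew_pencil =
  fixes W :: "'a::euclidean_space set" and a :: "'a \<Rightarrow> 'a \<Rightarrow> real" and T :: "'a \<Rightarrow> 'a"
  assumes subspace: "subspace W" and bilinear: "bilinear a" and alt: "a x x = 0"
    and linear: "linear T" and inv: "x \<in> W \<Longrightarrow> T x \<in> W"
    and alt_op: "x \<in> W \<Longrightarrow> a (T x) x = 0"
    and nondeg: "x \<in> W \<Longrightarrow> (\<And>y. y \<in> W \<Longrightarrow> a x y = 0) \<Longrightarrow> x = 0"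
    and no_eigenvector: "x \<in> W \<Longrightarrow> T x = r *\<^sub>R x \<Longrightarrow> x = 0"
begin

lemmas a_simps = bilinear_ladd[OF bilinear] bilinear_radd[OF bilinear]
  bilinear_lmul[OF bilinear] bilinear_rmul[OF bilinear] bilinear_lneg[OF bilinear] bilinear_rneg[OF bilinear]
  bilinear_lsub[OF bilinear] bilinear_rsub[OF bilinear] bilinear_lzero[OF bilinear] bilinear_rzero[OF bilinear]

lemmas T_simps = linear_add[OF linear] linear_diff[OF linear] linear_neg[OF linear]
  linear_scale[OF linear] linear_0[OF linear]

lemma antisymmetric: "a x y = - a y x"
  using alt[of x] alt[of y] alt[of "x + y"] by (simp add: a_simps)

text \<open>Polarisation of \<open>alt_op\<close> at \<open>x + y\<close>.\<close>

lemma selfadjoint: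
  assumes "x \<in> W" "y \<in> W"
  shows "a (T x) y = a x (T y)"
  using alt_op[of "x + y"] assms antisymmetric[of x "T y"]
  by (simp add: a_simps T_simps alt_op subspace_add[OF subspace])

lemma mem_W [simp]: "x \<in> W \<Longrightarrow> y \<in> W \<Longrightarrow> x + y \<in> W" "x \<in> W \<Longrightarrow> y \<in> W \<Longrightarrow> x - y \<in> W"
  "x \<in> W \<Longrightarrow> c *\<^sub>R x \<in> W" "x \<in> W \<Longrightarrow> - x \<in> W" "0 \<in> W"
  using subspace by (auto simp: subspace_add subspace_diff subspace_scale subspace_neg subspace_0)

lemma exists_prescribed:
  assumes "independent B" "B \<subseteq> W"
  shows "\<exists>y\<in>W. \<forall>b\<in>B. a b y = c b"
proof -
  \<comment> \<open>\<open>represent_functional\<close> represents in the first argument; the minus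
    sign anticipates the exchange of arguments.\<close>
  obtain f where f: "linear f" "\<And>b. b \<in> B \<Longrightarrow> f b = - c b"
    using linear_independent_extend[OF assms(1), of "\<lambda>b. - c b"] by auto
  obtain y where y: "y \<in> W" "\<And>x. x \<in> W \<Longrightarrow> a y x = f x"
    using represent_functional[OF bilinear subspace nondeg f(1)] by blast
  then have "a b y = c b" if "b \<in> B" for b
    using f(2)[OF that] that assms(2) antisymmetric[of b y] by auto
  with y(1) show ?thesis by blast
qed

lemma rescale:
  assumes "v \<noteq> 0"
  shows "skew_pencil W a (rescaled T u v)"
proof (rule skew_pencil.intro)
  show "linear (rescaled T u v)"
    unfolding rescaled_def by (intro linearI) (simp_all add: T_simps algebra_simps)
  show "x = 0" if x: "x \<in> W" "rescaled T u v x = r *\<^sub>R x" for x r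
  proof -
    have "v *\<^sub>R rescaled T u v x = v *\<^sub>R r *\<^sub>R x" using x by simp
    then have "T x = (v * r + u) *\<^sub>R x" using assms by (simp add: rescaled_def algebra_simps)
    with x no_eigenvector show ?thesis by blast
  qed
qed (auto simp: rescaled_def subspace bilinear alt inv alt_op a_simps intro: nondeg)

text \<open>The image of a selfadjoint operator is the orthogonal complement of its kernel. With a
  right inverse \<open>h\<close> of \<open>Q\<close>, let \<open>z\<close> represent the functional
  sending \<open>u\<close> to \<open>a x (h u)\<close>. Then
  \<open>a (Q z) v = a z (Q v) = a x (h (Q v))\<close>, which equals \<open>a x v\<close> because
  \<open>h (Q v) - v\<close> lies in the kernel.\<close>

lemma in_image_if_orthogonal_to_kernel:
  fixes Q
  assumes Q: "linear Q" "\<And>x. x \<in> W \<Longrightarrow> Q x \<in> W" "\<And>x y. x \<in> W \<Longrightarrow> y \<in> W \<Longrightarrow> a (Q x) y = a x (Q y)"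
    and x: "x \<in> W" "\<And>y. y \<in> W \<Longrightarrow> Q y = 0 \<Longrightarrow> a x y = 0"
  shows "\<exists>z\<in>W. Q z = x"
proof -
  obtain h where h: "range h \<subseteq> W" "linear h" "\<And>v. v \<in> W \<Longrightarrow> Q (h (Q v)) = Q v"
    using linear_exists_right_inverse_on[OF Q(1) subspace] by auto
  have "linear (\<lambda>u. a x (h u))"
    using linear_compose[OF h(2), of "a x"] bilinear by (simp add: bilinear_def o_def)
  then obtain z where z: "z \<in> W" "\<And>u. u \<in> W \<Longrightarrow> a z u = a x (h u)"
    using represent_functional[OF bilinear subspace nondeg] by blast
  have "a (Q z - x) v = 0" if v: "v \<in> W" for v
  proof -
    have hv: "h (Q v) \<in> W" using h(1) by blast
    have "a x (h (Q v) - v) = 0"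
      using v h(3) hv by (intro x(2)) (simp_all add: linear_diff[OF Q(1)])
    then show ?thesis using v Q z by (simp add: a_simps)
  qed
  then have "Q z - x = 0" using Q(2) z x by (intro nondeg) auto
  with z show ?thesis by auto
qed

end

section \<open>Standard pairs and orthogonal splitting\<close>

text \<open>The quadratic relation is asked of \<open>x\<close> only. In a pencil with operator
  \<open>S\<close>, selfadjointness moves powers of \<open>S\<close> from \<open>y\<close> to
  \<open>x\<close> and cyclic subspaces are isotropic, so both forms on
  \<open>x, S x, y, S y\<close> are determined.\<close>

definition std_pair :: "('a::real_vector \<Rightarrow> 'a \<Rightarrow> real) \<Rightarrow> ('a \<Rightarrow> 'a) \<Rightarrow> 'a \<Rightarrow> 'a \<Rightarrow> bool" where
  "std_pair a S x y \<longleftrightarrow> S (S x) = - x \<and> a x y = 0 \<and> a (S x) y = 1"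

text \<open>Completing the square turns the relation into (T - u)^2 x = - v^2 x.\<close>

lemma rescaled_square_eq:
  assumes "linear T" "v \<noteq> 0" "T (T x) = (2 * u) *\<^sub>R T x - (u\<^sup>2 + v\<^sup>2) *\<^sub>R x"
  shows "rescaled T u v (rescaled T u v x) = - x"
proof -
  have "rescaled T u v (rescaled T u v x) = (1 / v\<^sup>2) *\<^sub>R (T (T x) - (2 * u) *\<^sub>R T x + u\<^sup>2 *\<^sub>R x)"
    by (simp add: rescaled_def linear_diff[OF assms(1)] linear_scale[OF assms(1)] algebra_simps power2_eq_square
        flip: scaleR_2)
  also have "T (T x) - (2 * u) *\<^sub>R T x + u\<^sup>2 *\<^sub>R x = - (v\<^sup>2 *\<^sub>R x)" using assms(3) by (simp add: algebra_simps)
  finally show ?thesis using assms(2) by simp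
qed

context skew_pencil
begin

lemma selfadjoint_power:
  assumes "x \<in> W" "y \<in> W"
  shows "a ((T ^^ k) x) y = a x ((T ^^ k) y)"
  using assms(1)
proof (induct k arbitrary: x)
  case (Suc k)
  have "(T ^^ k) y \<in> W" for k using assms(2) by (induct k) (auto intro: inv)
  then show ?case using Suc selfadjoint[of x "(T ^^ k) y"] inv by (simp add: funpow_swap1)
qed simp

text \<open>Selfadjointness distributes the powers evenly over the two arguments: an even exponent
  reduces to \<open>alt\<close>, an odd one to \<open>alt_op\<close>.\<close>

lemma cyclic_isotropic:
  assumes "x \<in> W"
  shows "a ((T ^^ k) x) x = 0"
proof -
  have mem: "(T ^^ j) x \<in> W" for j using assms by (induct j) (auto intro: inv)
  obtain j where "k = j + j \<or> k = Suc (j + j)" by (metis oddE evenE mult_2 Suc_eq_plus1)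
  then show ?thesis
  proof
    assume "k = j + j"
    then show ?thesis using selfadjoint_power[OF mem assms, of j j] by (simp add: funpow_add alt)
  next
    assume "k = Suc (j + j)"
    then have "(T ^^ k) x = (T ^^ j) (T ((T ^^ j) x))" by (simp add: funpow_add funpow_swap1)
    then show ?thesis using selfadjoint_power[OF inv[OF mem] assms, of j j] alt_op[OF mem] by simp
  qed
qed

text \<open>Without real eigenvectors \<open>x\<close> and \<open>T x\<close> are independent, so
  their pairings with \<open>y\<close> can be prescribed.\<close>

lemma exists_std_partner:
  assumes x: "x \<in> W" "x \<noteq> 0" "T (T x) = - x"
  shows "\<exists>y\<in>W. std_pair a T x y"
proof -
  have "T x \<notin> span {x}"
    using x(1,2) no_eigenvector[of x] by (auto simp: span_singleton)
  then have "independent {T x, x}" "T x \<noteq> x"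
    using x(2) by (auto simp: independent_insert span_base)
  then obtain y where "y \<in> W" "\<forall>b\<in>{T x, x}. a b y = (if b = T x then 1 else 0)"
    using exists_prescribed[of "{T x, x}" "\<lambda>b. if b = T x then 1 else 0"] x(1) inv by auto
  then show ?thesis using x(3) \<open>T x \<noteq> x\<close> by (auto simp: std_pair_def)
qed

lemma exists_complex_line:
  assumes "W \<noteq> {0}"
  shows "\<exists>u v x. v > 0 \<and> x \<in> W \<and> x \<noteq> 0 \<and> rescaled T u v (rescaled T u v x) = - x"
proof -
  obtain x0 where x0: "x0 \<in> W" "x0 \<noteq> 0" using assms mem_W(5) by blast
  have "\<exists>u v x. v > 0 \<and> x \<in> W \<and> x \<noteq> 0 \<and> T (T x) = (2 * u) *\<^sub>R T x - (u\<^sup>2 + v\<^sup>2) *\<^sub>R x"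
    by (rule invariant_plane_exists[OF linear subspace inv no_eigenvector x0])
  then obtain u v x
    where "v > 0" "x \<in> W" "x \<noteq> 0" "T (T x) = (2 * u) *\<^sub>R T x - (u\<^sup>2 + v\<^sup>2) *\<^sub>R x" by blast
  then show ?thesis using rescaled_square_eq[OF linear, of v x u] by fastforce
qed

lemma exists_std_pair:
  assumes "W \<noteq> {0}"
  shows "\<exists>u v x y. v > 0 \<and> x \<in> W \<and> y \<in> W \<and> std_pair a (rescaled T u v) x y"
proof -
  obtain u v x where x: "v > 0" "x \<in> W" "x \<noteq> 0" "rescaled T u v (rescaled T u v x) = - x"
    using exists_complex_line[OF assms] by blast
  then interpret S: skew_pencil W a "rescaled T u v" by (intro rescale) simp
  show ?thesis using S.exists_std_partner[OF x(2-4)] x by blast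
qed

text \<open>Here the partner also satisfies the quadratic relation, so the span \<open>V1\<close> of
  the pair and its images is invariant. The form is nondegenerate on \<open>V1\<close>, hence
  \<open>V1\<close> and its orthogonal complement \<open>V2\<close> together span \<open>W\<close>,
  and \<open>V2\<close> is again a pencil.\<close>

lemma split_off_std_pair:
  assumes mem: "x \<in> W" "y \<in> W" and x: "T (T x) = - x" and y: "T (T y) = - y"
    and xy: "a x y \<noteq> 0" and dim: "dim W > 4"
  shows "\<exists>V1 V2 y. V1 \<subseteq> W \<and> V2 \<subseteq> W \<and> x \<in> V1 \<and> y \<in> V1 \<and> V2 \<noteq> {0} \<and> T ` V1 \<subseteq> V1 \<and> subspace V1 \<and>
     std_pair a T x y \<and> (\<forall>u\<in>V1. \<forall>w\<in>V2. a u w = 0) \<and> skew_pencil V2 a T"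
proof -
  define A B where "A = a x y" and "B = a (T x) y"
  define D where "D = A\<^sup>2 + B\<^sup>2"
  have D: "D \<noteq> 0" using xy by (simp add: D_def A_def)
  \<comment> \<open>With \<open>T\<close> acting as i, this is \<open>y\<close> divided by B + iA:
    the combination of \<open>y\<close> and \<open>T y\<close> that pairs to 0 with \<open>x\<close>
    and to 1 with \<open>T x\<close>.\<close>
  define y' where "y' = (B / D) *\<^sub>R y - (A / D) *\<^sub>R T y"
  have y'W: "y' \<in> W" using mem inv by (simp add: y'_def)
  have Ty': "T (T y') = - y'" by (simp add: y'_def T_simps y)
  have xTy: "a x (T y) = B" "a (T x) (T y) = - A"
    using selfadjoint[of x y] selfadjoint[of "T x" y] mem inv x by (simp_all add: A_def B_def a_simps)
  have 1: "a x y' = 0"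
    by (simp add: y'_def a_simps xTy flip: A_def)
  have "a (T x) y' = (B * B + A * A) / D"
    by (simp add: y'_def a_simps xTy add_divide_distrib flip: B_def)
  then have 2: "a (T x) y' = 1" using D by (simp add: D_def power2_eq_square add.commute)
  have 3: "a x (T y') = 1" "a (T x) (T y') = 0"
    using selfadjoint[of x y'] selfadjoint[of "T x" y'] mem inv x y'W 1 2 by (simp_all add: a_simps)
  have 4: "a x (T x) = 0" "a y' (T y') = 0" "a (T x) x = 0" "a (T y') y' = 0"
    using alt_op mem y'W antisymmetric[of x "T x"] antisymmetric[of y' "T y'"] by simp_all
  have 5: "a y' x = 0" "a (T y') x = - 1" "a y' (T x) = -1" "a (T y') (T x) = 0"
    using 1 2 3 antisymmetric[of y' x] antisymmetric[of "T y'" x] antisymmetric[of y' "T x"]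
      antisymmetric[of "T y'" "T x"] by simp_all
  define B0 where "B0 = {x, T x, y', T y'}"
  define V1 where "V1 = span B0"
  define V2 where "V2 = {w \<in> W. \<forall>u\<in>V1. a u w = 0}"
  have V1W: "V1 \<subseteq> W" unfolding V1_def B0_def
    using subspace mem y'W inv by (intro span_minimal) auto
  have V2I: "w \<in> V2" if "w \<in> W" "\<And>u. u \<in> B0 \<Longrightarrow> a u w = 0" for w
  proof -
    have "linear (\<lambda>u. a u w)" using bilinear by (simp add: bilinear_def)
    then have "a u w = 0" if "u \<in> V1" for u
      using that linear_eq_0_on_span[of "\<lambda>u. a u w" B0 u] \<open>\<And>u. u \<in> B0 \<Longrightarrow> a u w = 0\<close> by (auto simp: V1_def)
    then show ?thesis using that by (simp add: V2_def)
  qed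
  have TV1: "T ` V1 \<subseteq> V1"
  proof -
    have "T ` B0 \<subseteq> span B0" unfolding B0_def using x Ty' by (auto intro: span_base span_neg)
    then have "span (T ` B0) \<subseteq> span B0" by (intro span_minimal) auto
    then show ?thesis unfolding V1_def linear_span_image[OF linear] .
  qed
  have decomp: "\<exists>u1\<in>V1. u - u1 \<in> V2" if u: "u \<in> W" for u
  proof
    \<comment> \<open>The projection of \<open>u\<close> to \<open>V1\<close>. Each basis vector
      gets the pairing of \<open>u\<close> with its dual partner: \<open>x\<close> goes with
      \<open>T y'\<close>, \<open>T x\<close> with \<open>y'\<close>, and conversely up to
      sign.\<close>
    define u1 where "u1 = a u (T y') *\<^sub>R x + a u y' *\<^sub>R T x - a u (T x) *\<^sub>R y' - a u x *\<^sub>R T y'"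
    show "u1 \<in> V1" unfolding u1_def V1_def B0_def
      by (intro span_add span_diff span_scale span_base) auto
    then have u1W: "u1 \<in> W" using V1W by blast
    have "a p (u - u1) = 0" if "p \<in> B0" for p
      using that antisymmetric[of u p] unfolding B0_def
      by (auto simp: u1_def a_simps 1 2 3 4 5 alt)
    then show "u - u1 \<in> V2" using u u1W by (intro V2I) auto
  qed
  have subV2: "subspace V2"
    unfolding V2_def using subspace by (auto simp: subspace_def a_simps)
  have "skew_pencil V2 a T"
  proof (rule skew_pencil.intro)
    show "T w \<in> V2" if "w \<in> V2" for w
    proof -
      have "a u (T w) = 0" if u: "u \<in> V1" for u
      proof -
        have "u \<in> W" "T u \<in> V1" using u V1W TV1 by auto
        then show ?thesis using selfadjoint[of u w] \<open>w \<in> V2\<close> by (auto simp: V2_def)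
      qed
      then show ?thesis using that inv by (auto simp: V2_def)
    qed
    show "v = 0" if v: "v \<in> V2" "\<And>w. w \<in> V2 \<Longrightarrow> a v w = 0" for v
    proof (rule nondeg)
      fix u assume "u \<in> W"
      then obtain u1 where u1: "u1 \<in> V1" "u - u1 \<in> V2" using decomp by blast
      have "a u1 v = 0" using v(1) u1(1) by (simp add: V2_def)
      then have "a v u1 = 0" using antisymmetric[of v u1] by simp
      moreover have "a v (u - u1) = 0" using v u1 by blast
      ultimately show "a v u = 0" by (simp add: a_simps)
    qed (use v in \<open>simp add: V2_def\<close>)
    show "w = 0" if "w \<in> V2" "T w = r *\<^sub>R w" for w r
      using that no_eigenvector by (auto simp: V2_def)
  qed (use subV2 bilinear alt linear alt_op in \<open>auto simp: V2_def\<close>)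
  moreover have "V2 \<noteq> {0}"
  proof
    assume "V2 = {0}"
    then have "W \<subseteq> V1" using decomp by fastforce
    then have "dim W \<le> card B0" unfolding V1_def by (intro dim_le_card) (auto simp: B0_def)
    also have "\<dots> \<le> 4" unfolding B0_def by (simp add: card_insert_if)
    finally show False using dim by simp
  qed
  moreover have "x \<in> V1" "y' \<in> V1" by (auto simp: V1_def B0_def span_base)
  moreover have "std_pair a T x y'" by (simp add: std_pair_def 1 2 x)
  moreover have "V2 \<subseteq> W" "\<forall>u\<in>V1. \<forall>w\<in>V2. a u w = 0" "subspace V1" by (auto simp: V2_def V1_def)
  ultimately show ?thesis using V1W TV1 by blast
qed

text \<open>The remaining case, \<open>x\<close> orthogonal to the kernel of Q = T^2 + 1. Then
  \<open>x = Q z\<close>, so Q^2 kills \<open>z\<close>. The vectors \<open>z, T z, T x, x\<close>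
  are independent: \<open>Q\<close> kills the last two and sends the first two to the independent
  \<open>x\<close> and \<open>T x\<close>. So the pairings with \<open>y\<close> are free.\<close>

lemma exists_nilpotent_pair:
  assumes x: "x \<in> W" "x \<noteq> 0" "T (T x) = - x"
    and orth: "\<And>y. y \<in> W \<Longrightarrow> T (T y) = - y \<Longrightarrow> a x y = 0"
  shows "\<exists>z\<in>W. \<exists>y\<in>W. T (T (T (T z))) = - 2 *\<^sub>R T (T z) - z \<and>
    a z y = 0 \<and> a (T z) y = 0 \<and> a (T (T z)) y = -2 \<and> a (T (T (T z))) y = 0"
proof -
  define Q where "Q v = T (T v) + v" for v
  have Q: "linear Q" unfolding Q_def by (intro linearI) (simp_all add: T_simps algebra_simps)
  have "\<exists>z\<in>W. Q z = x"
  proof (rule in_image_if_orthogonal_to_kernel[OF Q])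
    show "a (Q p) q = a p (Q q)" if "p \<in> W" "q \<in> W" for p q
      using that selfadjoint inv by (simp add: Q_def a_simps)
  qed (use x orth inv in \<open>auto simp: Q_def add_eq_0_iff2\<close>)
  then obtain z where z: "z \<in> W" "Q z = x" by blast
  have QT: "Q (T v) = T (Q v)" for v by (simp add: Q_def T_simps)
  have Qx: "Q x = 0" "Q (T x) = 0" using x(3) by (simp_all add: Q_def T_simps)
  have kill: "Q v = 0" if "v \<in> span {T x, x}" for v
    using that linear_eq_0_on_span[OF Q, of "{T x, x}" v] Qx by auto
  have "T x \<notin> span {x}"
    using x(1,2) no_eigenvector[of x] by (auto simp: span_singleton)
  then have ind2: "independent {T x, x}" "T x \<noteq> x"
    using x(2) by (auto simp: independent_insert span_base)
  have "T x \<noteq> 0" using no_eigenvector[of x 0] x by auto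
  then have "T z \<notin> span {T x, x}" using kill[of "T z"] z(2) QT by auto
  then have ind3: "independent {T z, T x, x}" "T z \<noteq> x"
    using ind2 by (auto simp: independent_insert span_base)
  have "z \<notin> span {T z, T x, x}"
  proof
    assume "z \<in> span {T z, T x, x}"
    then obtain k where "Q (z - k *\<^sub>R T z) = 0" using kill by (auto simp: span_insert[of "T z"])
    then have kx: "x = k *\<^sub>R T x" using z(2) by (simp add: linear_diff[OF Q] linear_scale[OF Q] QT)
    then have "T x = (1 / k) *\<^sub>R x" using x(2) by (metis divideR_right scaleR_zero_left divide_inverse mult_1)
    then show False using no_eigenvector[of x] x by blast
  qed
  then have ind4: "independent {z, T z, T x, x}" "z \<noteq> x"
    using ind3 by (auto simp: independent_insert span_base)
  \<comment> \<open>The value -2 at \<open>x = Q z\<close> makes \<open>(1/2) *\<^sub>R Q z\<close>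
    pair with \<open>y\<close> to -1, as the table \<open>g10_2\<close> demands of its second and
    seventh vectors.\<close>
  then obtain y where y: "y \<in> W" "\<forall>b\<in>{z, T z, T x, x}. a b y = (if b = x then - 2 else 0)"
    using exists_prescribed[of "{z, T z, T x, x}" "\<lambda>b. if b = x then - 2 else 0"] x(1) z(1) inv by auto
  have x': "x = T (T z) + z" using z(2) by (simp add: Q_def)
  have "a z y = 0" "a (T z) y = 0" "a x y = - 2" "a (T x) y = 0"
    using y(2) ind2(2) ind3(2) ind4(2) by auto
  moreover have "T (T (T (T z))) = - 2 *\<^sub>R T (T z) - z"
  proof -
    have "T (T (T (T z))) + T (T z) = - (T (T z) + z)" using x(3) unfolding x' by (simp add: T_simps)
    then show ?thesis by (simp add: algebra_simps scaleR_2 eq_neg_iff_add_eq_0)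
  qed
  ultimately show ?thesis using z(1) y(1) unfolding x' by (auto simp: T_simps a_simps)
qed

end

section \<open>From Gram matrices to structure constants\<close>

lemma independent_family_if_coefficients_zero:
  fixes x :: "nat \<Rightarrow> 'a::real_vector"
  assumes fin: "finite I"
    and dual: "\<And>c j. j \<in> I \<Longrightarrow> (\<Sum>i\<in>I. c i *\<^sub>R x i) = 0 \<Longrightarrow> c j = 0"
  shows "inj_on x I \<and> independent (x ` I)"
proof
  show inj: "inj_on x I"
  proof (rule inj_onI, rule ccontr)
    fix i j assume ij: "i \<in> I" "j \<in> I" "x i = x j" "i \<noteq> j"
    let ?c = "\<lambda>k. (if k = i then 1 else 0) - (if k = j then 1 else 0) :: real"
    have "(\<Sum>k\<in>I. ?c k *\<^sub>R x k) = 0"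
      using ij fin by (simp add: scaleR_diff_left sum_subtractf if_distrib[of "\<lambda>c. c *\<^sub>R _"] sum.delta cong: if_cong)
    from dual[OF ij(1) this] ij show False by simp
  qed
  show "independent (x ` I)"
  proof (rule independent_if_scalars_zero)
    fix f v assume "(\<Sum>v\<in>x ` I. f v *\<^sub>R v) = 0" "v \<in> x ` I"
    then show "f v = 0" using dual[of _ "\<lambda>i. f (x i)"] by (auto simp: sum.reindex[OF inj])
  qed (simp add: fin)
qed

text \<open>Assumption \<open>dual\<close> says that \<open>q\<close> has a monomial Gram matrix on the list, as the
  coefficient form of the last basis vector does in each of the tables.\<close>

lemma iso_to_if_gram:
  fixes br :: "'a::euclidean_space \<Rightarrow> 'a \<Rightarrow> 'a" and es :: "'a list"
  assumes br: "bilinear br" "\<And>x. br x x = 0"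
    and n: "DIM('a) = k + 2" and len: "length es = k"
    and d: "independent {d1, d2}" "d1 \<noteq> d2" "\<And>y. br d1 y = 0" "\<And>y. br d2 y = 0"
    and forms: "\<And>x y. x \<in> set es \<Longrightarrow> y \<in> set es \<Longrightarrow> br x y = p x y *\<^sub>R d1 + q x y *\<^sub>R d2"
    and q: "bilinear q" "\<And>y. q d1 y = 0" "\<And>y. q d2 y = 0"
    and dual: "\<forall>i<k. \<exists>j<k. q (es ! i) (es ! j) \<noteq> 0 \<and> (\<forall>i'<k. i' \<noteq> i \<longrightarrow> q (es ! i') (es ! j) = 0)"
    and table: "\<forall>i<k. \<forall>j<k. i < j \<longrightarrow> c (Suc i) (Suc j) =
      (\<lambda>l. p (es ! i) (es ! j) * ev (k + 1) l + q (es ! i) (es ! j) * ev (k + 2) l)"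
    and table0: "\<And>i j. i < j \<Longrightarrow> k < j \<Longrightarrow> c i j = (\<lambda>l. 0)"
  shows "iso_to br (k + 2) c"
proof -
  \<comment> \<open>The tables count the basis from 1, the list counts from 0.\<close>
  define x where "x i = (es @ [d1, d2]) ! (i - 1)" for i
  have xi: "x (Suc i) = es ! i" if "i < k" for i using that by (simp add: x_def nth_append len)
  have xd: "x (k + 1) = d1" "x (k + 2) = d2" by (simp_all add: x_def nth_append len)
  have set: "{1..k + 2} = Suc ` {..<k} \<union> {k + 1, k + 2}"
    unfolding lessThan_atLeast0 image_Suc_atLeastLessThan by auto
  have sum: "(\<Sum>i=1..k + 2. f i) = (\<Sum>i<k. f (Suc i)) + f (k + 1) + f (k + 2)" for f :: "nat \<Rightarrow> 'a"
  proof -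
    have "(\<Sum>i=1..k + 2. f i) = (\<Sum>i\<in>Suc ` {..<k}. f i) + (\<Sum>i\<in>{k + 1, k + 2}. f i)"
      unfolding set by (intro sum.union_disjoint) auto
    then show ?thesis by (simp add: sum.reindex)
  qed
  have ind: "inj_on x {1..k + 2} \<and> independent (x ` {1..k + 2})"
  proof (rule independent_family_if_coefficients_zero)
    fix c j assume "(\<Sum>i=1..k + 2. c i *\<^sub>R x i) = 0" and j: "j \<in> {1..k + 2}"
    then have eq: "(\<Sum>i<k. c (Suc i) *\<^sub>R es ! i) + c (k + 1) *\<^sub>R d1 + c (k + 2) *\<^sub>R d2 = 0"
      unfolding sum xd by (simp add: xi)
    have c0: "c (Suc i) = 0" if i: "i < k" for i
    proof -
      from dual i obtain m where m: "m < k" "q (es ! i) (es ! m) \<noteq> 0"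
        "\<And>i'. i' < k \<Longrightarrow> i' \<noteq> i \<Longrightarrow> q (es ! i') (es ! m) = 0" by blast
      have lq: "linear (\<lambda>v. q v (es ! m))" using q(1) by (simp add: bilinear_def)
      \<comment> \<open>Pairing the relation with \<open>es ! m\<close> removes \<open>d1\<close>
        and \<open>d2\<close> by the assumptions on \<open>q\<close>, and every other term because
        column \<open>m\<close> of the Gram matrix has a single nonzero entry.\<close>
      have "0 = q ((\<Sum>i<k. c (Suc i) *\<^sub>R es ! i) + c (k + 1) *\<^sub>R d1 + c (k + 2) *\<^sub>R d2) (es ! m)"
        unfolding eq using bilinear_lzero[OF q(1)] by simp
      also have "\<dots> = (\<Sum>i<k. c (Suc i) * q (es ! i) (es ! m))"
        by (simp add: linear_add[OF lq] linear_scale[OF lq] linear_sum[OF lq] q)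
      also have "\<dots> = (\<Sum>i'<k. if i' = i then c (Suc i) * q (es ! i) (es ! m) else 0)"
        using m(3) by (intro sum.cong) auto
      also have "\<dots> = c (Suc i) * q (es ! i) (es ! m)" using i by simp
      finally show ?thesis using m(2) by simp
    qed
    then have "c (k + 1) *\<^sub>R d1 + c (k + 2) *\<^sub>R d2 = 0" using eq by simp
    then have "(\<Sum>v\<in>{d1, d2}. (if v = d1 then c (k + 1) else c (k + 2)) *\<^sub>R v) = 0" using d(2) by auto
    from independentD[OF d(1) _ subset_refl this, of d1] independentD[OF d(1) _ subset_refl this, of d2] d(2)
    have "c (k + 1) = 0" "c (k + 2) = 0" by auto
    then show "c j = 0" using j c0 unfolding set by auto
  qed simp
  then have "card (x ` {1..k + 2}) = DIM('a)" by (simp add: card_image n)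
  then have span: "span (x ` {1..k + 2}) = UNIV"
    using ind card_ge_dim_independent[of "x ` {1..k + 2}" UNIV] by auto
  have brd: "br y d1 = 0" "br y d2 = 0" for y
  proof -
    have "br y z = - br z y" for z
      using br(2)[of y] br(2)[of z] br(2)[of "y + z"]
      by (simp add: bilinear_ladd[OF br(1)] bilinear_radd[OF br(1)] add_eq_0_iff2)
    then show "br y d1 = 0" "br y d2 = 0" using d by simp_all
  qed
  have tab: "br (x i) (x j) = (\<Sum>l=1..k + 2. c i j l *\<^sub>R x l)"
    if ij: "i \<in> {1..k + 2}" "j \<in> {1..k + 2}" "i < j" for i j
  proof (cases "j \<le> k")
    case False
    then have "x j = d1 \<or> x j = d2" using ij xd by (metis Suc_eq_plus1 add_2_eq_Suc' atLeastAtMost_iff le_SucE)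
    then show ?thesis using brd table0[OF ij(3)] False by auto
  next
    case True
    then obtain i' j' where ij': "i = Suc i'" "j = Suc j'" "i' < k" "j' < k" "i' < j'"
      using ij by (metis Suc_le_D Suc_less_eq Suc_le_eq atLeastAtMost_iff le_trans One_nat_def less_imp_le)
    then have "br (x i) (x j) = p (es ! i') (es ! j') *\<^sub>R d1 + q (es ! i') (es ! j') *\<^sub>R d2"
      using forms len by (simp add: xi)
    also have "\<dots> = (\<Sum>l=1..k + 2. c i j l *\<^sub>R x l)"
      using table ij' unfolding sum xd by (simp add: ev_def)
    finally show ?thesis .
  qed
  have "br (x i) (x j) = (\<Sum>l=1..k + 2. antisym_ext c i j l *\<^sub>R x l)"
    if ij: "i \<in> {1..k + 2}" "j \<in> {1..k + 2}" for i j
  proof -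
    consider "i < j" | "i = j" | "j < i" by linarith
    then show ?thesis
    proof cases
      case 3
      have "br (x i) (x j) = - br (x j) (x i)"
        using br(2)[of "x i"] br(2)[of "x j"] br(2)[of "x i + x j"]
        by (simp add: bilinear_ladd[OF br(1)] bilinear_radd[OF br(1)] add_eq_0_iff2)
      then show ?thesis using tab[OF ij(2,1) 3] 3 by (simp add: antisym_ext_def sum_negf)
    qed (use tab ij br in \<open>simp_all add: antisym_ext_def\<close>)
  qed
  then show ?thesis unfolding iso_to_def using ind span by blast
qed

section \<open>Normal forms of central brackets\<close>

text \<open>The two forms of the pencil are the coordinates of the bracket. As \<open>a\<close>
  vanishes on \<open>d1\<close> and \<open>d2\<close>, it can serve as the form \<open>q\<close> of
  \<open>iso_to_if_gram\<close>.\<close>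

locale central_bracket = skew_pencil W a T
  for W :: "'a::euclidean_space set" and a T +
  fixes br :: "'a \<Rightarrow> 'a \<Rightarrow> 'a" and d1 d2 :: 'a
  assumes br_bilinear: "bilinear br" and br_alt: "br x x = 0"
    and br_forms: "x \<in> W \<Longrightarrow> y \<in> W \<Longrightarrow> br x y = a (T x) y *\<^sub>R d1 + a x y *\<^sub>R d2"
    and d_independent: "independent {d1, d2}" and d_neq: "d1 \<noteq> d2"
    and br_d: "br d1 y = 0" "br d2 y = 0" and a_d: "a d1 y = 0" "a d2 y = 0"
begin

text \<open>Writing T = u + v S splits \<open>a (T x) y\<close> into
  \<open>v * a (S x) y + u * a x y\<close>; the second summand joins the coefficient of
  \<open>d2\<close>, which becomes \<open>d2 + u *\<^sub>R d1\<close>.\<close>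

lemma rescale_bracket:
  assumes "v \<noteq> 0"
  shows "central_bracket W a (rescaled T u v) br (v *\<^sub>R d1) (d2 + u *\<^sub>R d1)"
proof -
  interpret S: skew_pencil W a "rescaled T u v" using assms by (rule rescale)
  have c0: "s = 0 \<and> t = 0" if "s *\<^sub>R d1 + t *\<^sub>R d2 = 0" for s t
  proof -
    have "(\<Sum>w\<in>{d1, d2}. (if w = d1 then s else t) *\<^sub>R w) = 0" using that d_neq by auto
    from independentD[OF d_independent _ subset_refl this, of d1]
      independentD[OF d_independent _ subset_refl this, of d2] d_neq
    show ?thesis by auto
  qed
  have "v *\<^sub>R d1 \<noteq> 0" using c0[of v 0] assms by auto
  moreover have "d2 + u *\<^sub>R d1 \<notin> span {v *\<^sub>R d1}"
  proof
    assume "d2 + u *\<^sub>R d1 \<in> span {v *\<^sub>R d1}"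
    then obtain k where "d2 + u *\<^sub>R d1 = k *\<^sub>R v *\<^sub>R d1" by (auto simp: span_singleton)
    then show False using c0[of "u - k * v" 1] by (simp add: algebra_simps)
  qed
  ultimately have "independent {d2 + u *\<^sub>R d1, v *\<^sub>R d1}" "d2 + u *\<^sub>R d1 \<noteq> v *\<^sub>R d1"
    by (auto simp: independent_insert span_base)
  then show ?thesis
  proof (unfold_locales, goal_cases)
    case (3 x y)
    then show ?case using br_forms[of x y] assms by (simp add: rescaled_def a_simps algebra_simps)
  qed (auto simp: br_bilinear br_alt br_d a_d a_simps insert_commute bilinear_ladd[OF br_bilinear]
      bilinear_lmul[OF br_bilinear])
qed

lemma iso_to_if_gram_op:
  assumes "DIM('a) = k + 2" "length es = k" "set es \<subseteq> W"
    and "\<forall>i<k. \<exists>j<k. a (es ! i) (es ! j) \<noteq> 0 \<and> (\<forall>i'<k. i' \<noteq> i \<longrightarrow> a (es ! i') (es ! j) = 0)"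
    and "\<forall>i<k. \<forall>j<k. i < j \<longrightarrow> c (Suc i) (Suc j) =
      (\<lambda>l. a (T (es ! i)) (es ! j) * ev (k + 1) l + a (es ! i) (es ! j) * ev (k + 2) l)"
    and "\<And>i j. i < j \<Longrightarrow> k < j \<Longrightarrow> c i j = (\<lambda>l. 0)"
  shows "iso_to br (k + 2) c"
  using br_forms assms(3)
  by (intro iso_to_if_gram[OF br_bilinear br_alt assms(1,2) d_independent d_neq br_d _ bilinear a_d assms(4-6)]) auto

lemma iso_to_g6:
  assumes n: "DIM('a) = 6" and mem: "x \<in> W" "y \<in> W" and std: "std_pair a T x y"
  shows "iso_to br 6 g6"
proof -
  have vals: "T (T x) = - x" "a x y = 0" "a (T x) y = 1" "a x (T y) = 1" "a (T x) (T y) = 0"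
    "a x x = 0" "a (T x) x = 0" "a x (T x) = 0" "a y y = 0" "a (T y) y = 0" "a y (T y) = 0"
    "a (T x) (T x) = 0" "a (T y) (T y) = 0" "a (T (T y)) y = 0" "a (T (T y)) (T y) = 0"
    using std selfadjoint[OF mem] selfadjoint[of "T x" y] selfadjoint[of x x] selfadjoint[of y y]
      selfadjoint[of "T y" y] inv mem alt alt_op
    by (auto simp: std_pair_def a_simps)
  have vals': "a y x = 0" "a y (T x) = -1" "a (T y) x = - 1" "a (T y) (T x) = 0"
    using vals antisymmetric[of y x] antisymmetric[of y "T x"] antisymmetric[of "T y" x]
      antisymmetric[of "T y" "T x"] by simp_all
  have "iso_to br (4 + 2) g6"
  \<comment> \<open>The negated images supply the coefficients -1 of the table; \<open>d1\<close>
    and \<open>d2\<close> become the fifth and sixth basis vectors.\<close>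
  proof (rule iso_to_if_gram_op[of _ "[x, - T x, y, - T y]"])
    show "\<forall>i<4. \<exists>j<4. a ([x, - T x, y, - T y] ! i) ([x, - T x, y, - T y] ! j) \<noteq> 0 \<and>
      (\<forall>i'<4. i' \<noteq> i \<longrightarrow> a ([x, - T x, y, - T y] ! i') ([x, - T x, y, - T y] ! j) = 0)"
      by (simp add: numeral_eq_Suc All_less_Suc Ex_less_Suc vals vals' a_simps)
    show "\<forall>i<4. \<forall>j<4. i < j \<longrightarrow> g6 (Suc i) (Suc j) =
      (\<lambda>l. a (T ([x, - T x, y, - T y] ! i)) ([x, - T x, y, - T y] ! j) * ev (4 + 1) l +
           a ([x, - T x, y, - T y] ! i) ([x, - T x, y, - T y] ! j) * ev (4 + 2) l)"
      by (simp add: numeral_eq_Suc All_less_Suc vals vals' a_simps T_simps g6_def fun_eq_iff)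
  qed (use n mem inv in \<open>auto simp: g6_def fun_eq_iff\<close>)
  then show ?thesis by simp
qed

lemma iso_to_g10_2:
  assumes n: "DIM('a) = 10" and mem: "z \<in> W" "y \<in> W"
    and z: "T (T (T (T z))) = - 2 *\<^sub>R T (T z) - z"
    and zy: "a z y = 0" "a (T z) y = 0" "a (T (T z)) y = -2" "a (T (T (T z))) y = 0"
  shows "iso_to br 10 (g10_2 1)"
proof -
  text \<open>On the span of \<open>z\<close> and \<open>y\<close> under \<open>T\<close>, where \<open>Q\<^sup>2 = 0\<close>, the semisimple part of \<open>T\<close> is
    \<open>J = T + T Q / 2\<close> and the nilpotent part is \<open>N = - T Q / 2\<close>, so that \<open>J N = Q / 2\<close>. The basis
    below consists of \<open>- N w\<close>, \<open>J N w\<close>, \<open>w\<close>, \<open>- J w\<close> for \<open>w = z\<close> and \<open>w = y\<close>.\<close>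
  define Q where "Q v = T (T v) + v" for v
  define es where "es = [(1/2) *\<^sub>R T (Q z), (1/2) *\<^sub>R Q z, z, - T z - (1/2) *\<^sub>R T (Q z),
    (1/2) *\<^sub>R T (Q y), (1/2) *\<^sub>R Q y, y, - T y - (1/2) *\<^sub>R T (Q y)]"
  have move: "a p (T q) = a (T p) q" if "p \<in> W" "q \<in> W" for p q using selfadjoint that by simp
  \<comment> \<open>The entries of \<open>es\<close> involve powers of \<open>T\<close> up to 3, so
    the two Gram matrices need exponents up to 3 + 3 + 1.\<close>
  have iso: "a v v = 0" "a (T v) v = 0" "a (T (T v)) v = 0" "a (T (T (T v))) v = 0"
    "a (T (T (T (T v)))) v = 0" "a (T (T (T (T (T v))))) v = 0" "a (T (T (T (T (T (T v)))))) v = 0"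
    "a (T (T (T (T (T (T (T v))))))) v = 0" if "v \<in> W" for v
    using cyclic_isotropic[OF that, of 0] cyclic_isotropic[OF that, of 1] cyclic_isotropic[OF that, of 2]
      cyclic_isotropic[OF that, of 3] cyclic_isotropic[OF that, of 4] cyclic_isotropic[OF that, of 5]
      cyclic_isotropic[OF that, of 6] cyclic_isotropic[OF that, of 7]
    by (simp_all add: numeral_eq_Suc)
  \<comment> \<open>The relation for \<open>z\<close> gives these pairings the recursion c(k+4) = -2
    c(k+2) - c(k), starting from 0, 0, 2, 0.\<close>
  have yz: "a y z = 0" "a (T y) z = 0" "a (T (T y)) z = 2" "a (T (T (T y))) z = 0"
    "a (T (T (T (T y)))) z = - 4" "a (T (T (T (T (T y))))) z = 0" "a (T (T (T (T (T (T y)))))) z = 6"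
    using zy z move mem inv antisymmetric[of y z] antisymmetric[of "T y" z]
      antisymmetric[of "T (T y)" z] antisymmetric[of "T (T (T y))" z]
      antisymmetric[of "T (T (T (T y)))" z] antisymmetric[of "T (T (T (T (T y))))" z]
      antisymmetric[of "T (T (T (T (T (T y)))))" z]
    by (simp_all add: a_simps T_simps)
  have W: "z \<in> W" "y \<in> W" "\<And>v. v \<in> W \<Longrightarrow> T v \<in> W" by (simp_all add: mem inv)
  have gram: "\<forall>i<8. \<forall>j<8. a (es ! i) (es ! j) =
    (if (i, j) \<in> {(0,7), (1,6), (2,5), (3,4)} then -1
     else if (j, i) \<in> {(0,7), (1,6), (2,5), (3,4)} then 1 else 0)"
    unfolding es_def Q_def
    by (simp add: numeral_eq_Suc All_less_Suc a_simps T_simps move iso W z zy yz)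
  have "iso_to br (8 + 2) (g10_2 1)"
  proof (rule iso_to_if_gram_op[of _ es])
    show "\<forall>i<8. \<exists>j<8. a (es ! i) (es ! j) \<noteq> 0 \<and> (\<forall>i'<8. i' \<noteq> i \<longrightarrow> a (es ! i') (es ! j) = 0)"
      using gram by (simp add: numeral_eq_Suc All_less_Suc Ex_less_Suc)
    have "\<forall>i<8. \<forall>j<8. i < j \<longrightarrow> a (T (es ! i)) (es ! j) =
      (if (i, j) \<in> {(0,6), (2,4), (2,7), (3,6)} then 1
       else if (i, j) \<in> {(1,7), (3,5)} then - 1 else 0)"
      unfolding es_def Q_def
      by (simp add: numeral_eq_Suc All_less_Suc a_simps T_simps move iso W z zy yz)
    then show "\<forall>i<8. \<forall>j<8. i < j \<longrightarrow> g10_2 1 (Suc i) (Suc j) =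
      (\<lambda>l. a (T (es ! i)) (es ! j) * ev (8 + 1) l + a (es ! i) (es ! j) * ev (8 + 2) l)"
      using gram by (simp add: numeral_eq_Suc All_less_Suc g10_2_def fun_eq_iff)
  qed (use n W in \<open>auto simp: g10_2_def fun_eq_iff es_def Q_def\<close>)
  then show ?thesis by simp
qed

text \<open>Each summand carries a standard pair, for \<open>T\<close> on \<open>V1\<close> and for
  S = (T - u)/v on \<open>V2\<close>. Since T = u + v S on \<open>V2\<close>, the parameter
  \<open>l\<close> is \<open>v\<close>; \<open>m\<close> is \<open>- u\<close> because the images
  under \<open>S\<close> enter the basis negated.\<close>

lemma iso_to_g10_1:
  assumes n: "DIM('a) = 10" and V1: "V1 \<subseteq> W" "T ` V1 \<subseteq> V1" and V2: "V2 \<subseteq> W" "T ` V2 \<subseteq> V2"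
    and sub: "subspace V1" "subspace V2"
    and orth: "\<And>p q. p \<in> V1 \<Longrightarrow> q \<in> V2 \<Longrightarrow> a p q = 0"
    and mem1: "x \<in> V1" "y \<in> V1" and mem2: "x' \<in> V2" "y' \<in> V2"
    and std: "std_pair a T x y" and std': "std_pair a (rescaled T u v) x' y'" and v: "v \<noteq> 0"
  shows "iso_to br 10 (g10_1 (- u) v)"
proof -
  interpret S: skew_pencil W a "rescaled T u v" using v by (rule rescale)
  define S where "S = rescaled T u v"
  have memW: "x \<in> W" "y \<in> W" "x' \<in> W" "y' \<in> W" using mem1 mem2 V1 V2 by auto
  have TS: "T w = u *\<^sub>R w + v *\<^sub>R S w" for w using v by (simp add: S_def rescaled_def)
  \<comment> \<open>The operator is left arbitrary, since the values serve for \<open>T\<close> on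
    the first pair and for \<open>S\<close> on the second.\<close>
  have vals: "a p q = 0" "a (T p) q = 1" "a p (T q) = 1" "a (T p) (T q) = 0"
    "a p p = 0" "a (T p) p = 0" "a p (T p) = 0" "a q q = 0" "a (T q) q = 0" "a q (T q) = 0"
    "a (T p) (T p) = 0" "a (T q) (T q) = 0" "a (T (T q)) q = 0" "a (T (T q)) (T q) = 0"
    "a q p = 0" "a q (T p) = -1" "a (T q) p = - 1" "a (T q) (T p) = 0" "T (T p) = - p"
    if "skew_pencil W a T" "std_pair a T p q" "p \<in> W" "q \<in> W" for T p q
  proof -
    interpret P: skew_pencil W a T by fact
    note mem = that(3,4)
    show "a p q = 0" "a (T p) q = 1" "T (T p) = - p" using that(2) by (simp_all add: std_pair_def)
    then show *: "a p (T q) = 1" "a (T p) (T q) = 0" using P.selfadjoint[OF mem] P.selfadjoint[of "T p" q] mem P.inv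
      by (auto simp: a_simps)
    show "a p p = 0" "a (T p) p = 0" "a p (T p) = 0" "a q q = 0" "a (T q) q = 0" "a q (T q) = 0"
      "a (T p) (T p) = 0" "a (T q) (T q) = 0" "a (T (T q)) q = 0" "a (T (T q)) (T q) = 0"
      using P.selfadjoint[of p p] P.selfadjoint[of q q] P.selfadjoint[of "T q" q] P.inv mem P.alt P.alt_op by auto
    show "a q p = 0" "a q (T p) = -1" "a (T q) p = - 1" "a (T q) (T p) = 0"
      using \<open>a p q = 0\<close> \<open>a (T p) q = 1\<close> * antisymmetric[of q p] antisymmetric[of q "T p"] antisymmetric[of "T q" p]
        antisymmetric[of "T q" "T p"] by simp_all
  qed
  note vals1 = vals[OF skew_pencil_axioms std memW(1,2)]
  note vals2 = vals[OF S.skew_pencil_axioms std' memW(3,4), folded S_def]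
  have mem1': "T p \<in> V1" if "p \<in> V1" for p using that V1 by auto
  have mem2': "S p \<in> V2" if "p \<in> V2" for p
    using that V2 sub by (auto simp: S_def rescaled_def intro!: subspace_scale subspace_diff)
  have orth': "a q p = 0" if "p \<in> V1" "q \<in> V2" for p q using orth that antisymmetric[of q p] by simp
  define es where "es = [x, - T x, y, - T y, x', - S x', y', - S y']"
  note facts = vals1 vals2 orth orth' mem1 mem2 mem1' mem2' a_simps
  have gram: "\<forall>i<8. \<forall>j<8. a (es ! i) (es ! j) =
    (if (i, j) \<in> {(0,3), (1,2), (4,7), (5,6)} then -1
     else if (j, i) \<in> {(0,3), (1,2), (4,7), (5,6)} then 1 else 0)"
    unfolding es_def by (simp add: numeral_eq_Suc All_less_Suc facts)
  have "iso_to br (8 + 2) (g10_1 (- u) v)"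
  proof (rule iso_to_if_gram_op[of _ es])
    show "\<forall>i<8. \<exists>j<8. a (es ! i) (es ! j) \<noteq> 0 \<and> (\<forall>i'<8. i' \<noteq> i \<longrightarrow> a (es ! i') (es ! j) = 0)"
      using gram by (simp add: numeral_eq_Suc All_less_Suc Ex_less_Suc)
    have T': "T (S x') = u *\<^sub>R S x' - v *\<^sub>R x'" "T (S y') = u *\<^sub>R S y' + v *\<^sub>R S (S y')"
       "T x' = u *\<^sub>R x' + v *\<^sub>R S x'" "T y' = u *\<^sub>R y' + v *\<^sub>R S y'"
      using TS[of "S x'"] TS[of "S y'"] TS[of x'] TS[of y']
      by (simp_all add: vals2)
    have "\<forall>i<8. \<forall>j<8. i < j \<longrightarrow> a (T (es ! i)) (es ! j) =
      (if (i, j) = (0,2) then 1 else if (i, j) = (1,3) then - 1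
       else if (i, j) = (4,6) then v else if (i, j) = (5,7) then - v
       else if (i, j) \<in> {(4,7), (5,6)} then - u else 0)"
      unfolding es_def
      by (simp add: numeral_eq_Suc All_less_Suc T' T_simps(2) linear_neg[OF linear] facts)
    then show "\<forall>i<8. \<forall>j<8. i < j \<longrightarrow> g10_1 (- u) v (Suc i) (Suc j) =
      (\<lambda>l. a (T (es ! i)) (es ! j) * ev (8 + 1) l + a (es ! i) (es ! j) * ev (8 + 2) l)"
      using gram by (simp add: numeral_eq_Suc All_less_Suc g10_1_def fun_eq_iff)
  qed (use n memW inv S.inv in \<open>auto simp: g10_1_def fun_eq_iff es_def S_def\<close>)
  then show ?thesis by simp
qed

lemma classification_10:
  assumes n: "DIM('a) = 10" and dimW: "dim W = 8"
  shows "(\<exists>m l. 0 < \<bar>l\<bar> \<and> \<bar>l\<bar> \<le> 1 \<and> iso_to br 10 (g10_1 m l)) \<or> (\<exists>l. l \<noteq> 0 \<and> iso_to br 10 (g10_2 l))"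
proof -
  have "W \<noteq> {0}" using dimW by auto
  then obtain u v x where v: "v > 0" and x: "x \<in> W" "x \<noteq> 0" "rescaled T u v (rescaled T u v x) = - x"
    using exists_complex_line by blast
  define S where "S = rescaled T u v"
  interpret S: central_bracket W a S br "v *\<^sub>R d1" "d2 + u *\<^sub>R d1"
    unfolding S_def using v by (intro rescale_bracket) simp
  have Sx: "S (S x) = - x" using x by (simp add: S_def)
  show ?thesis
  proof (cases "\<exists>y\<in>W. S (S y) = - y \<and> a x y \<noteq> 0")
    case False
    then obtain z y where "z \<in> W" "y \<in> W" "S (S (S (S z))) = - 2 *\<^sub>R S (S z) - z"
      "a z y = 0" "a (S z) y = 0" "a (S (S z)) y = -2" "a (S (S (S z))) y = 0"
      using S.exists_nilpotent_pair[OF x(1,2) Sx] by blast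
    \<comment> \<open>After rescaling, the parameter in this case is always 1.\<close>
    then have "iso_to br 10 (g10_2 1)" by (rule S.iso_to_g10_2[OF n])
    then show ?thesis by (metis zero_neq_one)
  next
    case True
    then obtain y0 where "y0 \<in> W" "S (S y0) = - y0" "a x y0 \<noteq> 0" by blast
    moreover have "4 < dim W" using dimW by simp
    ultimately obtain V1 V2 y where V1: "V1 \<subseteq> W" "S ` V1 \<subseteq> V1" and sub1: "subspace V1" and V2: "V2 \<subseteq> W" "V2 \<noteq> {0}"
      and mem1: "x \<in> V1" "y \<in> V1" and std: "std_pair a S x y"
      and orth: "\<And>p q. p \<in> V1 \<Longrightarrow> q \<in> V2 \<Longrightarrow> a p q = 0" and P2: "skew_pencil V2 a S"
      using S.split_off_std_pair[OF x(1) _ Sx] by metis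
    interpret P2: skew_pencil V2 a S by (rule P2)
    have inv2: "S ` V2 \<subseteq> V2" using P2.inv by blast
    obtain u' v' x' y' where v': "v' > 0" and mem2: "x' \<in> V2" "y' \<in> V2"
      and std': "std_pair a (rescaled S u' v') x' y'"
      using P2.exists_std_pair[OF V2(2)] by blast
    show ?thesis
    proof (cases "v' \<le> 1")
      case True
      have "iso_to br 10 (g10_1 (- u') v')"
        using S.iso_to_g10_1[OF n V1 V2(1) inv2 sub1 P2.subspace orth mem1 mem2 std std'] v' by simp
      then show ?thesis using True v' by (metis abs_of_pos)
    next
      case False
      text \<open>The second eigenvalue lies higher in the upper half plane, so it is the one to move to \<open>i\<close>.\<close>
      define R where "R = rescaled S u' v'"
      interpret R: central_bracket W a R br "v' *\<^sub>R v *\<^sub>R d1" "d2 + u *\<^sub>R d1 + u' *\<^sub>R v *\<^sub>R d1"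
        unfolding R_def using v' by (intro S.rescale_bracket) simp
      \<comment> \<open>Solving R = (S - u')/v' for \<open>S\<close>: seen from \<open>R\<close>,
        the first summand has parameters - u'/v' and 1/v', the latter now below 1.\<close>
      have S_eq: "S = rescaled R (- u' / v') (1 / v')"
        using v' by (simp add: fun_eq_iff R_def rescaled_def algebra_simps)
      have inv: "R ` V1 \<subseteq> V1" "R ` V2 \<subseteq> V2"
        using V1(2) inv2 sub1 P2.subspace
        by (auto simp: R_def rescaled_def intro!: subspace_scale subspace_diff)
      have orth': "a q p = 0" if "q \<in> V2" "p \<in> V1" for p q
        using orth[OF that(2,1)] antisymmetric[of q p] by simp
      have "iso_to br 10 (g10_1 (- (- u' / v')) (1 / v'))"
      proof (rule R.iso_to_g10_1[OF n V2(1) inv(2) V1(1) inv(1) P2.subspace sub1 orth' mem2 mem1])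
        show "std_pair a R x' y'" using std' by (simp add: R_def)
        show "std_pair a (rescaled R (- u' / v') (1 / v')) x y" using std by (simp only: S_eq)
        show "1 / v' \<noteq> 0" using v' by simp
      qed
      moreover have "0 < \<bar>1 / v'\<bar>" "\<bar>1 / v'\<bar> \<le> 1" using False v' by auto
      ultimately show ?thesis by blast
    qed
  qed
qed

end

section \<open>From coadjoint orbits to pencils\<close>

text \<open>The orbit dimension is the rank of the row map \<open>f\<close>. Modulo elements with
  zero bracket every vector lies in \<open>W\<close>, so \<open>f\<close> attains its rank on
  \<open>W\<close>, and a rank of at least \<open>dim W\<close> leaves no kernel there.\<close>

lemma orbit_dim_kernel_trivial:
  fixes br :: "'a::euclidean_space \<Rightarrow> 'a \<Rightarrow> 'a"
  assumes br: "bilinear br" and F: "linear F" and W: "subspace W" "dim W \<le> orbit_dim br F"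
    and UN: "\<And>u. \<exists>w\<in>W. \<forall>y. br (u - w) y = 0"
    and x: "x \<in> W" "\<And>y. F (br x y) = 0"
  shows "x = 0"
proof -
  define f where "f x = (\<Sum>b\<in>Basis. F (br x b) *\<^sub>R b)" for x :: 'a
  have f: "linear f" unfolding f_def
    by (intro linear_compose_sum ballI linearI)
      (simp_all add: bilinear_ladd[OF br] bilinear_lmul[OF br] linear_add[OF F] linear_scale[OF F] algebra_simps)
  have "range f \<subseteq> f ` W"
  proof clarify
    fix u
    obtain w where w: "w \<in> W" "\<And>y. br (u - w) y = 0" using UN by blast
    then have "f (u - w) = 0" by (simp add: f_def linear_0[OF F])
    then have "f u = f w" by (simp add: linear_diff[OF f])
    then show "f u \<in> f ` W" using w(1) by auto
  qed
  moreover have "orbit_dim br F = dim (range f)"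
    unfolding orbit_dim_def f_def[symmetric] linear_span_image[OF f] by (simp add: span_Basis)
  ultimately have "dim W \<le> dim (f ` W)" using W(2) dim_subset[of "range f" "f ` W"] by simp
  moreover have "f x = 0" using x(2) by (simp add: f_def)
  ultimately show ?thesis using kernel_trivial_if_dim_image_ge[OF f W(1)] x(1) by blast
qed

text \<open>Coordinates on the derived algebra split the bracket into forms \<open>b\<close> and
  \<open>a\<close>. The orbit condition for \<open>f2\<close> makes \<open>a\<close> nondegenerate
  on \<open>W\<close>, so \<open>b\<close> is \<open>a (T _) _\<close> for an operator
  \<open>T\<close>; the condition for \<open>f1 - r * f2\<close> excludes the eigenvalue
  \<open>r\<close>.\<close>

lemma central_bracket_exists:
  fixes br :: "'a::euclidean_space \<Rightarrow> 'a \<Rightarrow> 'a"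
  assumes MD: "MD_algebra (DIM('a) - 2) br" and dim2: "dim (derived br) = 2"
    and central: "derived br \<subseteq> centre br"
  shows "\<exists>W a T d1 d2. central_bracket W a T br d1 d2 \<and> dim W + 2 = DIM('a)"
proof -
  have br: "bilinear br" and alt: "\<And>x. br x x = 0"
    and orb: "\<And>F. linear F \<Longrightarrow> \<exists>u\<in>derived br. F u \<noteq> 0 \<Longrightarrow> orbit_dim br F = DIM('a) - 2"
    using MD by (auto simp: MD_algebra_def lie_algebra_def)
  have subD: "subspace (derived br)" by (simp add: derived_def)
  have mem: "br x y \<in> derived br" for x y unfolding derived_def by (intro span_base) blast
  have cen: "br d y = 0" if "d \<in> derived br" for d y using central that by (auto simp: centre_def)
  have anti: "br x y = - br y x" for x y
    using alt[of x] alt[of y] alt[of "x + y"]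
    by (simp add: bilinear_ladd[OF br] bilinear_radd[OF br] add_eq_0_iff2)
  obtain B where B: "B \<subseteq> derived br" "independent B" "derived br \<subseteq> span B" "card B = 2"
    using basis_exists[of "derived br"] dim2 by metis
  then obtain d1 d2 where d: "B = {d1, d2}" "d1 \<noteq> d2" by (meson card_2_iff)
  obtain f1 where f1: "linear f1" "f1 d1 = (1::real)" "f1 d2 = 0"
    using linear_independent_extend[OF B(2), of "\<lambda>b. if b = d1 then 1 else 0"] d by auto
  obtain f2 where f2: "linear f2" "f2 d1 = 0" "f2 d2 = (1::real)"
    using linear_independent_extend[OF B(2), of "\<lambda>b. if b = d2 then 1 else 0"] d by auto
  have coords: "w = f1 w *\<^sub>R d1 + f2 w *\<^sub>R d2" if "w \<in> derived br" for w
  proof -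
    have "linear (\<lambda>w. f1 w *\<^sub>R d1 + f2 w *\<^sub>R d2)"
      by (intro linearI) (simp_all add: linear_add[OF f1(1)] linear_add[OF f2(1)] linear_scale[OF f1(1)]
          linear_scale[OF f2(1)] algebra_simps)
    moreover have "v = f1 v *\<^sub>R d1 + f2 v *\<^sub>R d2" if "v \<in> B" for v using that d f1 f2 by auto
    ultimately show ?thesis using linear_eq_on_span[OF linear_ident, of _ B w] that B(3) by blast
  qed
  \<comment> \<open>The inner product serves only to choose a linear complement of the derived
    algebra.\<close>
  define W where "W = {y \<in> UNIV. \<forall>x \<in> derived br. orthogonal x y}"
  have dimW: "dim W + 2 = DIM('a)"
    using dim_subspace_orthogonal_to_vectors[OF subD subspace_UNIV] dim2 by (simp add: W_def)
  have W: "subspace W"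
    by (auto simp: W_def subspace_def orthogonal_def inner_right_distrib)
  have decomp: "\<exists>w\<in>W. u - w \<in> derived br" for u
  proof -
    obtain y z where "y \<in> span (derived br)" "\<And>w. w \<in> span (derived br) \<Longrightarrow> orthogonal z w" "u = y + z"
      using orthogonal_subspace_decomp_exists by blast
    then show ?thesis
      using span_base by (intro bexI[of _ z]) (auto simp: W_def orthogonal_commute derived_def span_span)
  qed
  define a where "a x y = f2 (br x y)" for x y
  define b where "b x y = f1 (br x y)" for x y
  have a: "bilinear a" and b: "bilinear b"
    unfolding a_def b_def bilinear_def
    using br linear_compose[OF _ f1(1)] linear_compose[OF _ f2(1)] by (auto simp: bilinear_def o_def)
  have kernel: "x = 0" if x: "x \<in> W" "\<And>y. y \<in> W \<Longrightarrow> F (br x y) = 0" and F: "linear F" "F d1 \<noteq> 0 \<or> F d2 \<noteq> 0" for x and F :: "'a \<Rightarrow> real"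
  proof -
    have "\<exists>u\<in>derived br. F u \<noteq> 0" using F(2) B(1) d(1) by blast
    then have "dim W \<le> orbit_dim br F" using orb[OF F(1)] dimW by simp
    moreover have "F (br x y) = 0" for y
    proof -
      obtain w where w: "w \<in> W" "y - w \<in> derived br" using decomp by blast
      have "br x (y - w) = 0" using cen[OF w(2)] anti[of x "y - w"] by simp
      then show ?thesis using x(2)[OF w(1)] by (simp add: bilinear_rsub[OF br])
    qed
    ultimately show ?thesis
      using orbit_dim_kernel_trivial[OF br F(1) W, of x] decomp cen x(1) by blast
  qed
  have nondeg: "x = 0" if "x \<in> W" "\<And>y. y \<in> W \<Longrightarrow> a x y = 0" for x
    using kernel[OF that(1), of f2] that(2) f2 by (simp add: a_def)
  have "\<exists>t\<in>W. \<forall>y\<in>W. a t y = b x y" for x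
    using b by (intro represent_functional[OF a W nondeg]) (auto simp: bilinear_def)
  \<comment> \<open>\<open>T\<close> is chosen pointwise; its linearity follows from the uniqueness
    of representing vectors in \<open>W\<close>.\<close>
  then obtain T where T: "\<And>x. T x \<in> W" "\<And>x y. y \<in> W \<Longrightarrow> a (T x) y = b x y" by metis
  have eqI: "s = t" if "s \<in> W" "t \<in> W" "\<And>y. y \<in> W \<Longrightarrow> a s y = a t y" for s t
    using nondeg[of "s - t"] that subspace_diff[OF W] by (simp add: bilinear_lsub[OF a])
  have linT: "linear T"
    by (intro linearI eqI)
      (simp_all add: T subspace_add[OF W] subspace_scale[OF W] bilinear_ladd[OF a] bilinear_ladd[OF b]
        bilinear_lmul[OF a] bilinear_lmul[OF b])
  have "skew_pencil W a T"
  proof (rule skew_pencil.intro)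
    show "x = 0" if x: "x \<in> W" "T x = r *\<^sub>R x" for x r
    \<comment> \<open>An eigenvector for \<open>r\<close> pairs to zero with \<open>W\<close> under
      b - r a, the form of a functional with value 1 at \<open>d1\<close>.\<close>
    proof (rule kernel[of x "\<lambda>w. f1 w - r * f2 w"])
      show "f1 (br x y) - r * f2 (br x y) = 0" if "y \<in> W" for y
        using T(2)[OF that, of x] x(2) by (simp add: bilinear_lmul[OF a]) (simp add: a_def b_def)
      show "linear (\<lambda>w. f1 w - r * f2 w)"
        by (intro linearI) (simp_all add: linear_add[OF f1(1)] linear_add[OF f2(1)] linear_scale[OF f1(1)]
          linear_scale[OF f2(1)] algebra_simps)
    qed (use x f1 f2 in auto)
  qed (use W a linT T nondeg alt linear_0[OF f1(1)] linear_0[OF f2(1)] in \<open>auto simp: a_def b_def\<close>)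
  moreover have "br x y = a (T x) y *\<^sub>R d1 + a x y *\<^sub>R d2" if "x \<in> W" "y \<in> W" for x y
    using coords[OF mem[of x y]] T(2)[OF that(2), of x] by (simp add: a_def b_def)
  moreover have "br d1 y = 0" "br d2 y = 0" for y using cen B(1) d(1) by auto
  ultimately have "central_bracket W a T br d1 d2"
    using br alt B(2) d linear_0[OF f2(1)]
    by (auto simp: central_bracket_def central_bracket_axioms_def a_def)
  with dimW show ?thesis by blast
qed

theorem theorem4p7:
  fixes br :: "'a::euclidean_space \<Rightarrow> 'a \<Rightarrow> 'a"
  assumes "MD_algebra (DIM('a) - 2) br"
    and "DIM('a) \<ge> 6"
    and "dim (derived br) = 2"
    and "derived br \<subseteq> centre br"
  shows "(DIM('a) = 6 \<longrightarrow> iso_to br 6 g6) \<and>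
         (DIM('a) = 10 \<longrightarrow>
            (\<exists>m l. 0 < \<bar>l\<bar> \<and> \<bar>l\<bar> \<le> 1 \<and> iso_to br 10 (g10_1 m l)) \<or>
            (\<exists>l. l \<noteq> 0 \<and> iso_to br 10 (g10_2 l)))"
proof -
  obtain W a T d1 d2 where "central_bracket W a T br d1 d2" and dimW: "dim W + 2 = DIM('a)"
    using central_bracket_exists[OF assms(1,3,4)] by blast
  then interpret central_bracket W a T br d1 d2 by simp
  have "iso_to br 6 g6" if n: "DIM('a) = 6"
  proof -
    have "W \<noteq> {0}" using dimW n by auto
    then obtain u v x y where v: "v > 0" and xy: "x \<in> W" "y \<in> W" "std_pair a (rescaled T u v) x y"
      using exists_std_pair by blast
    interpret S: central_bracket W a "rescaled T u v" br "v *\<^sub>R d1" "d2 + u *\<^sub>R d1"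
      using v by (intro rescale_bracket) simp
    show ?thesis using S.iso_to_g6[OF n xy] .
  qed
  then show ?thesis using classification_10 dimW by simp
qed

end
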